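(* Let $\mathcal{S},\mathcal{A}$ be finite, let $p$ be transition dynamics, $\gamma\in[0,1)$, $\boldsymbol{\phi}:\mathcal{S}\times\mathcal{A}\times\mathcal{S}\to\mathbb{R}^d$, and let $\mathcal{M}^{\phi}=\mathcal{M}^{\phi}(\mathcal{S},\mathcal{A},p,\gamma)$ be the set of all MDPs with these $\mathcal{S},\mathcal{A},p,\gamma$ whose expected reward has the form $r(s,a,s')=\boldsymbol{\phi}(s,a,s')^{\top}\mathbf{w}$ for some $\mathbf{w}\in\mathbb{R}^d$. Let $M_1,\dots,M_n\in\mathcal{M}^{\phi}$ be tasks with weight vectors $\mathbf{w}_1,\dots,\mathbf{w}_n$, and let $M_i\in\mathcal{M}^{\phi}$ be a task with weight vector $\mathbf{w}_i$. For each $j\in\{1,\dots,n\}$ let $Q_i^{\pi_j^*}$ be the action-value function of an optimal policy $\pi_j^*$ of $M_j$ when executed in $M_i$. Given approximations $\{\tilde{Q}_i^{\pi_1^*},\tilde{Q}_i^{\pi_2^*},\dots,\tilde{Q}_i^{\pi_n^*}\}$ (real-valued functions on $\mathcal{S}\times\mathcal{A}$) such that $$\left|Q_i^{\pi_j^*}(s,a)-\tilde{Q}_i^{\pi_j^*}(s,a)\right|\le\epsilon$$ for all $s\in\mathcal{S}$, $a\in\mathcal{A}$, and $j\in\{1,2,\dots,n\}$, let $\pi$ be a policy with $$\pi(s)\in\operatorname*{argmax}_{a}\max_{j}\tilde{Q}_i^{\pi_j^*}(s,a)\quad\text{for all } s\in\mathcal{S}.$$ Finally, let $\phi_{\max}=\max_{s,a}\|\boldsymbol{\phi}(s,a)\|$,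 where $\|\cdot\|$ is the norm induced by the inner product adopted on $\mathbb{R}^d$. Then, for all $s\in\mathcal{S}$ and $a\in\mathcal{A}$, $$Q_i^{\pi_i^*}(s,a)-Q_i^{\pi}(s,a)\le\frac{2}{1-\gamma}\left(\phi_{\max}\,\min_{j\in\{1,\dots,n\}}\|\mathbf{w}_i-\mathbf{w}_j\|+\epsilon\right),$$ where $\pi_i^*$ is an optimal policy of $M_i$ and $Q_i^{\pi}$ is the action-value function of $\pi$ in $M_i$.
   Context: A Markov decision process (MDP) is a tuple $(\mathcal{S},\mathcal{A},p,R,\gamma)$, where $\mathcal{S}$ and $\mathcal{A}$ are the (nonempty, finite) state and action spaces, $p(\cdot|s,a)$ is the next-state distribution after taking action $a$ in state $s$, $R(s,a,s')$ is the random reward at the transition $s\xrightarrow{a}s'$, with expected value $r(s,a,s')$, and $\gamma\in[0,1)$ is the discount factor. Write $r(s,a)=\mathbb{E}_{S'\sim p(\cdot|s,a)}[r(s,a,S')]$ and, correspondingly, $\boldsymbol{\phi}(s,a)=\mathbb{E}_{S'\sim p(\cdot|s,a)}[\boldsymbol{\phi}(s,a,S')]$, so that in a task with weight vector $\mathbf{w}$ one has $r(s,a)=\boldsymbol{\phi}(s,a)^{\top}\mathbf{w}$. Here $\mathbf{x}^\top\mathbf{y}$ denotes the inner product on $\mathbb{R}^d$ (the adopted inner product, e.g. the standard one, which induces the Euclidean norm). A policy is a mapping $\pi:\mathcal{S}\to\mathcal{A}$. For a task $M_i$ with expected reward $r_i$, the action-value function of $\pi$ in $M_i$ is $$Q_i^{\pi}(s,a)=\mathbb{E}^{\pi}\Big[\sum_{k=0}^{\infty}\gamma^{k}\,r_i(S_k,A_k)\,\Big|\,S_0=s,A_0=a\Big],$$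 where $S_{k+1}\sim p(\cdot|S_k,A_k)$ and $A_{k}=\pi(S_{k})$ for $k\ge1$. An optimal policy $\pi_j^*$ of $M_j$ is a policy maximizing the expected discounted return in $M_j$ from every state $s\in\mathcal{S}$. The notation $Q_i^{\pi_j^*}$ means the action-value function, computed with the rewards of $M_i$, of the policy $\pi_j^*$ that is optimal for $M_j$. *)

theory Defs
  imports "HOL-Probability.Probability"
begin

(* \<open>mdp_reward M s a s'\<close> is the law of the random reward R(s,a,s'). *)
record ('s, 'a) mdp =
  mdp_trans :: "'s \<Rightarrow> 'a \<Rightarrow> 's pmf"
  mdp_reward :: "'s \<Rightarrow> 'a \<Rightarrow> 's \<Rightarrow> real measure"
  mdp_discount :: real

definition is_mdp :: "('s, 'a) mdp \<Rightarrow> bool" where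
  "is_mdp M \<longleftrightarrow>
     0 \<le> mdp_discount M \<and> mdp_discount M < 1 \<and>
     (\<forall>s a s'. real_distribution (mdp_reward M s a s') \<and>
               integrable (mdp_reward M s a s') (\<lambda>x. x))"

definition transition_reward :: "('s, 'a) mdp \<Rightarrow> 's \<Rightarrow> 'a \<Rightarrow> 's \<Rightarrow> real" where
  "transition_reward M s a s' = (LINT x | mdp_reward M s a s'. x)"

definition expected_reward :: "('s, 'a) mdp \<Rightarrow> 's \<Rightarrow> 'a \<Rightarrow> real" where
  "expected_reward M s a =
     measure_pmf.expectation (mdp_trans M s a) (transition_reward M s a)"

definition expected_feature ::
    "('s \<Rightarrow> 'a \<Rightarrow> 's pmf) \<Rightarrow> ('s \<Rightarrow> 'a \<Rightarrow> 's \<Rightarrow> 'v::euclidean_space) \<Rightarrow> 's \<Rightarrow> 'a \<Rightarrow> 'v" where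
  "expected_feature p \<phi> s a = measure_pmf.expectation (p s a) (\<phi> s a)"

definition has_weights ::
    "('s \<Rightarrow> 'a \<Rightarrow> 's \<Rightarrow> 'v::euclidean_space) \<Rightarrow> ('s, 'a) mdp \<Rightarrow> 'v \<Rightarrow> bool" where
  "has_weights \<phi> M w \<longleftrightarrow> (\<forall>s a s'. transition_reward M s a s' = \<phi> s a s' \<bullet> w)"

definition mdp_family ::
    "('s \<Rightarrow> 'a \<Rightarrow> 's \<Rightarrow> 'v::euclidean_space) \<Rightarrow> ('s \<Rightarrow> 'a \<Rightarrow> 's pmf) \<Rightarrow> real \<Rightarrow> ('s, 'a) mdp set" where
  "mdp_family \<phi> p \<gamma> =
     {M. is_mdp M \<and> mdp_trans M = p \<and> mdp_discount M = \<gamma> \<and> (\<exists>w. has_weights \<phi> M w)}"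

(* Conditional law of (S_k, A_k) given the earlier pairs, when S_0 = s, A_0 = a
   and the policy chooses all later actions. *)
fun step_kernel ::
    "('s, 'a) mdp \<Rightarrow> ('s \<Rightarrow> 'a) \<Rightarrow> 's \<Rightarrow> 'a \<Rightarrow> nat \<Rightarrow> (nat \<Rightarrow> 's \<times> 'a) \<Rightarrow> ('s \<times> 'a) measure" where
  "step_kernel M \<pi> s a 0 \<omega> = measure_pmf (return_pmf (s, a))"
| "step_kernel M \<pi> s a (Suc k) \<omega> =
     measure_pmf (map_pmf (\<lambda>s'. (s', \<pi> s')) (mdp_trans M (fst (\<omega> k)) (snd (\<omega> k))))"

(* Law of the whole trajectory k \<mapsto> (S_k, A_k), by the Ionescu-Tulcea extension of the
   kernels above; the lemmas below discharge the side conditions of that construction. *)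
definition trajectory ::
    "('s, 'a) mdp \<Rightarrow> ('s \<Rightarrow> 'a) \<Rightarrow> 's \<Rightarrow> 'a \<Rightarrow> (nat \<Rightarrow> 's \<times> 'a) measure" where
  "trajectory M \<pi> s a =
     projective_family.lim UNIV
       (Ionescu_Tulcea.CI (step_kernel M \<pi> s a) (\<lambda>_. count_space UNIV)) (\<lambda>_. count_space UNIV)"

lemma Ionescu_Tulcea_step_kernel:
  "Ionescu_Tulcea (step_kernel M \<pi> s a) (\<lambda>_. count_space UNIV)"
proof (rule Ionescu_Tulcea.intro)
  fix i
  show "step_kernel M \<pi> s a i \<in>
    measurable (PiM {0..<i} (\<lambda>_. count_space UNIV)) (subprob_algebra (count_space UNIV))"
  proof (cases i)
    case 0
    have "step_kernel M \<pi> s a i = (\<lambda>_. measure_pmf (return_pmf (s, a)))"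
      by (auto simp: 0)
    moreover have "measure_pmf (return_pmf (s, a)) \<in> space (subprob_algebra (count_space UNIV))"
      by (simp add: measure_pmf_in_subprob_space)
    ultimately show ?thesis
      by simp
  next
    case (Suc k)
    define K where
      "K x = map_pmf (\<lambda>s'. (s', \<pi> s')) (mdp_trans M (fst x) (snd x))" for x
    have "step_kernel M \<pi> s a i = (\<lambda>x. measure_pmf (K x)) \<circ> (\<lambda>\<omega>. \<omega> k)"
      by (auto simp: Suc K_def)
    also have "\<dots> \<in> measurable (PiM {0..<i} (\<lambda>_. count_space UNIV))
        (subprob_algebra (count_space UNIV))"
    proof (rule measurable_comp)
      show "(\<lambda>\<omega>. \<omega> k) \<in> measurable (PiM {0..<i} (\<lambda>_. count_space UNIV)) (count_space UNIV)"
        by (rule measurable_component_singleton) (simp add: Suc)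
    qed (rule measurable_measure_pmf)
    finally show ?thesis .
  qed
next
  fix i and x :: "nat \<Rightarrow> 'a \<times> 'b"
  show "prob_space (step_kernel M \<pi> s a i x)"
    by (cases i) (simp_all add: measure_pmf.prob_space_axioms)
qed

lemma prob_space_trajectory: "prob_space (trajectory M \<pi> s a)"
proof -
  interpret Ionescu_Tulcea "step_kernel M \<pi> s a" "\<lambda>_. count_space UNIV"
    by (rule Ionescu_Tulcea_step_kernel)
  have "emeasure PF.lim (PF.emb UNIV {} {\<lambda>_. undefined}) = emeasure (CI {}) {\<lambda>_. undefined}"
    by (rule lim) (auto simp: PiM_empty)
  also have "\<dots> = 1"
    using prob_space.emeasure_space_1[OF PF.prob_space_P[of "{}"]]
    by (simp add: CI_def space_PiM)
  also have "PF.emb UNIV {} {\<lambda>_. undefined} = space PF.lim"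
    by (auto simp: prod_emb_def space_PiM restrict_def)
  finally show ?thesis
    unfolding trajectory_def by (rule prob_spaceI)
qed

definition discounted_return :: "('s, 'a) mdp \<Rightarrow> (nat \<Rightarrow> 's \<times> 'a) \<Rightarrow> real" where
  "discounted_return M \<omega> =
     (\<Sum>k. mdp_discount M ^ k * expected_reward M (fst (\<omega> k)) (snd (\<omega> k)))"

definition action_value :: "('s, 'a) mdp \<Rightarrow> ('s \<Rightarrow> 'a) \<Rightarrow> 's \<Rightarrow> 'a \<Rightarrow> real" where
  "action_value M \<pi> s a = (LINT \<omega> | trajectory M \<pi> s a. discounted_return M \<omega>)"

(* Expected discounted return from S_0 = s when the policy also chooses A_0. *)
definition state_value :: "('s, 'a) mdp \<Rightarrow> ('s \<Rightarrow> 'a) \<Rightarrow> 's \<Rightarrow> real" where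
  "state_value M \<pi> s = (LINT \<omega> | trajectory M \<pi> s (\<pi> s). discounted_return M \<omega>)"

definition optimal_policy :: "('s, 'a) mdp \<Rightarrow> ('s \<Rightarrow> 'a) \<Rightarrow> bool" where
  "optimal_policy M \<pi> \<longleftrightarrow> (\<forall>s \<pi>'. state_value M \<pi>' s \<le> state_value M \<pi> s)"

end

theory Submission
  imports Defs
begin

text \<open>
  Both ingredients come from the Bellman equation for action values: a quantity that is bounded by
  \<open>c\<close> plus \<open>\<gamma>\<close> times its own maximum is at most \<open>c / (1 - \<gamma>)\<close>. Applied to the difference of the values
  of one policy in two tasks, this bounds \<open>Q\<^sub>i\<^sup>\<pi> - Q\<^sub>j\<^sup>\<pi>\<close> by \<open>\<delta> / (1 - \<gamma>)\<close>, where \<open>\<delta>\<close> bounds the difference of the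
  rewards; as \<open>\<pi>\<^sub>j\<close> is optimal in task \<open>j\<close>, going from \<open>\<pi>\<^sub>i\<close> to \<open>\<pi>\<^sub>j\<close> in task \<open>i\<close> costs twice that much.
  Applied to the difference between the values of the policies \<open>\<pi>\<^sub>j\<close> and of the greedy policy,
  it yields generalized policy improvement up to \<open>2 \<epsilon> / (1 - \<gamma>)\<close>.
\<close>

section \<open>Marginal laws of the trajectory measure\<close>

primrec state_action_pmf ::
    "('s, 'a) mdp \<Rightarrow> ('s \<Rightarrow> 'a) \<Rightarrow> 's \<Rightarrow> 'a \<Rightarrow> nat \<Rightarrow> ('s \<times> 'a) pmf" where
  "state_action_pmf M \<pi> s a 0 = return_pmf (s, a)"
| "state_action_pmf M \<pi> s a (Suc k) =
     state_action_pmf M \<pi> s a k \<bind>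
       (\<lambda>x. map_pmf (\<lambda>s'. (s', \<pi> s')) (mdp_trans M (fst x) (snd x)))"

text \<open>The extension \<open>eP k\<close> draws a value from \<open>P k\<close> and writes it at
  position \<open>k\<close> of the history; reading off position \<open>k\<close> undoes the write
  and leaves only the draw.\<close>

lemma (in Ionescu_Tulcea) distr_C_last:
  assumes "\<omega> \<in> space (PiM {0..<0} M)"
  shows "distr (C 0 (Suc k) \<omega>) (M k) (\<lambda>x. x k) = C 0 k \<omega> \<bind> P k"
proof -
  have C: "space (C 0 k \<omega>) = space (PiM {0..<k} M)" "sets (C 0 k \<omega>) = sets (PiM {0..<k} M)"
    using space_C[OF assms, of k] sets_C[OF assms, of k] unfolding add_0 .
  \<comment> \<open>Needed for \<open>distr_bind\<close>: binding over an empty space gives a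
    default measure instead of a mixture.\<close>
  have nonempty: "space (C 0 k \<omega>) \<noteq> {}"
    by (rule prob_space.not_empty[OF prob_space_C[OF assms]])
  have "distr (C 0 (Suc k) \<omega>) (M k) (\<lambda>x. x k) =
      C 0 k \<omega> \<bind> (\<lambda>x. distr (eP k x) (M k) (\<lambda>x. x k))"
    unfolding C.simps
  proof (subst distr_bind)
    show "eP (0 + k) \<in> measurable (C 0 k \<omega>) (subprob_algebra (PiM {0..<Suc k} M))"
      by (simp add: measurable_cong_sets[OF C(2) refl])
    show "(\<lambda>x. x k) \<in> measurable (PiM {0..<Suc k} M) (M k)"
      by (rule measurable_component_singleton) simp
  qed (use nonempty in simp_all)
  also have "\<dots> = C 0 k \<omega> \<bind> P k"
  proof (rule bind_cong[OF refl])
    fix x assume "x \<in> space (C 0 k \<omega>)"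
    then have x: "x \<in> space (PiM {0..<k} M)"
      by (simp add: C)
    have "distr (eP k x) (M k) (\<lambda>x. x k) = distr (P k x) (M k) ((\<lambda>x. x k) \<circ> fun_upd x k)"
      unfolding eP_def
    proof (rule distr_distr)
      show "(\<lambda>x. x k) \<in> measurable (PiM {0..<Suc k} M) (M k)"
        by (rule measurable_component_singleton) simp
      have "fun_upd x k \<in> measurable (M k) (PiM {0..<Suc k} M)"
        by (rule measurable_fun_upd[where J="{0..<k}"]) (use x in auto)
      then show "fun_upd x k \<in> measurable (P k x) (PiM {0..<Suc k} M)"
        by (simp add: measurable_cong_sets[OF sets_P[OF x] refl])
    qed
    also have "\<dots> = distr (P k x) (P k x) (\<lambda>y. y)"
      by (rule distr_cong) (simp_all add: sets_P[OF x])
    finally show "distr (eP k x) (M k) (\<lambda>x. x k) = P k x"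
      by simp
  qed
  finally show ?thesis .
qed

text \<open>Coordinate \<open>k\<close> is already determined by the first \<open>Suc k\<close>
  coordinates, and on these the projective limit agrees with the finite-dimensional law
  \<open>C 0 (Suc k)\<close>.\<close>

lemma (in Ionescu_Tulcea) distr_lim_component:
  "distr PF.lim (M k) (\<lambda>\<omega>. \<omega> k) = C 0 k (\<lambda>_. undefined) \<bind> P k"
proof -
  let ?J = "{0..<Suc k}" and ?u = "\<lambda>_::nat. undefined :: 'a"
  \<comment> \<open>\<open>?u\<close> is the empty history, the only point of the product over no
    indices.\<close>
  have u: "?u \<in> space (PiM {0..<0} M)"
    by (simp add: space_PiM)
  have comp: "(\<lambda>\<omega>. \<omega> k) \<in> measurable (PiM ?J M) (M k)"
    by (rule measurable_component_singleton) simp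
  \<comment> \<open>\<open>CI ?J\<close> restricts the law of the first \<open>up_to ?J\<close>
    coordinates to \<open>?J\<close>; for this initial segment the restriction cuts nothing
    off.\<close>
  have "up_to ?J = Suc k"
    by (rule antisym) (use up_to_less[of ?J k] in \<open>auto simp: up_to_iff\<close>)
  then have CI: "CI ?J = C 0 (Suc k) ?u"
    unfolding CI_def using distr_C[of "Suc k" "Suc k" ?u 0] u by simp
  have "distr PF.lim (M k) (\<lambda>\<omega>. \<omega> k) =
      distr (distr PF.lim (PiM ?J M) (\<lambda>\<omega>. restrict \<omega> ?J)) (M k) (\<lambda>\<omega>. \<omega> k)"
  proof (subst distr_distr[OF comp])
    have "(\<lambda>\<omega>. restrict \<omega> ?J) \<in> measurable (PiM UNIV M) (PiM ?J M)"
      by (rule measurable_restrict_subset) simp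
    then show "(\<lambda>\<omega>. restrict \<omega> ?J) \<in> measurable PF.lim (PiM ?J M)"
      by (simp add: measurable_cong_sets[OF PF.sets_lim refl])
  qed (simp add: comp_def)
  also have "\<dots> = C 0 k ?u \<bind> P k"
    by (subst distr_lim) (simp_all only: finite_atLeastLessThan CI distr_C_last[OF u])
  finally show ?thesis .
qed

text \<open>Markov property: \<open>step_kernel\<close> looks at the history only through its last
  pair, so binding over histories collapses to binding over the law of that pair, which the
  induction hypothesis supplies.\<close>

lemma distr_trajectory:
  "distr (trajectory M \<pi> s a) (count_space UNIV) (\<lambda>\<omega>. \<omega> k) =
     measure_pmf (state_action_pmf M \<pi> s a k)"
proof -
  interpret Ionescu_Tulcea "step_kernel M \<pi> s a" "\<lambda>_. count_space UNIV"
    by (rule Ionescu_Tulcea_step_kernel)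
  let ?u = "\<lambda>_::nat. undefined :: 'a \<times> 'b"
  have u: "?u \<in> space (PiM {0..<0} (\<lambda>_. count_space UNIV))"
    by (simp add: space_PiM)
  have "C 0 k ?u \<bind> step_kernel M \<pi> s a k = measure_pmf (state_action_pmf M \<pi> s a k)"
  proof (induction k)
    case 0
    have "C 0 0 ?u \<bind> step_kernel M \<pi> s a 0 =
        C 0 0 ?u \<bind> (\<lambda>_. measure_pmf (return_pmf (s, a)))"
      by (rule bind_cong) simp_all
    also have "\<dots> = measure_pmf (return_pmf (s, a))"
      by (rule bind_const'[OF prob_space_C[OF u] measure_pmf.subprob_space_axioms])
    finally show ?case
      unfolding state_action_pmf.simps(1) .
  next
    case (Suc k)
    define K where "K x = map_pmf (\<lambda>s'. (s', \<pi> s')) (mdp_trans M (fst x) (snd x))" for x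
    have "C 0 (Suc k) ?u \<bind> step_kernel M \<pi> s a (Suc k) =
        C 0 (Suc k) ?u \<bind> (\<lambda>\<omega>. measure_pmf (K (\<omega> k)))"
      by (rule bind_cong) (simp_all add: K_def)
    also have "\<dots> = distr (C 0 (Suc k) ?u) (count_space UNIV) (\<lambda>\<omega>. \<omega> k) \<bind> (\<lambda>x. measure_pmf (K x))"
    proof (rule bind_distr[symmetric])
      have "(\<lambda>\<omega>. \<omega> k) \<in> measurable (PiM {0..<0 + Suc k} (\<lambda>_. count_space UNIV)) (count_space UNIV)"
        by (rule measurable_component_singleton) simp
      then show "(\<lambda>\<omega>. \<omega> k) \<in> measurable (C 0 (Suc k) ?u) (count_space UNIV)"
        using measurable_cong_sets[OF sets_C[OF u] refl] by blast
      show "space (C 0 (Suc k) ?u) \<noteq> {}"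
        by (rule prob_space.not_empty[OF prob_space_C[OF u]])
    qed (rule measurable_measure_pmf)
    also have "\<dots> = measure_pmf (state_action_pmf M \<pi> s a k) \<bind> (\<lambda>x. measure_pmf (K x))"
      by (simp only: distr_C_last[OF u] Suc.IH)
    also have "\<dots> = measure_pmf (state_action_pmf M \<pi> s a (Suc k))"
      by (simp add: measure_pmf_bind K_def)
    finally show ?case .
  qed
  then show ?thesis
    unfolding trajectory_def distr_lim_component .
qed

lemma measurable_trajectory_component [measurable]:
  "(\<lambda>\<omega>. \<omega> k) \<in> measurable (trajectory M \<pi> s a) (count_space UNIV)"
proof -
  interpret Ionescu_Tulcea "step_kernel M \<pi> s a" "\<lambda>_. count_space UNIV"
    by (rule Ionescu_Tulcea_step_kernel)
  show ?thesis
    unfolding trajectory_def measurable_cong_sets[OF PF.sets_lim refl]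
    by (rule measurable_component_singleton) simp
qed

lemma integral_trajectory:
  fixes f :: "'s \<times> 'a \<Rightarrow> real"
  shows "(LINT \<omega>|trajectory M \<pi> s a. f (\<omega> k)) =
    measure_pmf.expectation (state_action_pmf M \<pi> s a k) f"
  by (subst distr_trajectory[symmetric], subst integral_distr) simp_all

section \<open>Transition operator, value series and Bellman equation\<close>

definition next_expectation ::
    "('s, 'a) mdp \<Rightarrow> ('s \<Rightarrow> 'a) \<Rightarrow> ('s \<times> 'a \<Rightarrow> real) \<Rightarrow> 's \<times> 'a \<Rightarrow> real" where
  "next_expectation M \<pi> f x =
     measure_pmf.expectation (mdp_trans M (fst x) (snd x)) (\<lambda>s'. f (s', \<pi> s'))"

lemma expectation_mono_finite:
  fixes f g :: "'s::finite \<Rightarrow> real"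
  assumes "\<And>x. f x \<le> g x"
  shows "measure_pmf.expectation q f \<le> measure_pmf.expectation q g"
  by (rule integral_mono) (auto simp: assms integrable_measure_pmf_finite)

lemma expectation_le_const_finite:
  fixes f :: "'s::finite \<Rightarrow> real"
  assumes "\<And>x. f x \<le> c"
  shows "measure_pmf.expectation q f \<le> c"
  using expectation_mono_finite[of f "\<lambda>_. c" q] assms by simp

lemma abs_expectation_le_finite:
  fixes f :: "'s::finite \<Rightarrow> real"
  assumes "\<And>x. \<bar>f x\<bar> \<le> c"
  shows "\<bar>measure_pmf.expectation q f\<bar> \<le> c"
  by (rule order_trans[OF integral_abs_bound expectation_le_const_finite[OF assms]])

text \<open>Duality between pushing laws forward and pulling functions back: integrating out the
  last step replaces \<open>f\<close> by \<open>next_expectation M \<pi> f\<close>, hence the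
  induction over arbitrary \<open>f\<close>.\<close>

lemma expectation_state_action_pmf:
  fixes M :: "('s::finite, 'a::finite) mdp"
  shows "measure_pmf.expectation (state_action_pmf M \<pi> s a k) f =
    (next_expectation M \<pi> ^^ k) f (s, a)"
proof (induction k arbitrary: f)
  case (Suc k)
  have "measure_pmf.expectation (state_action_pmf M \<pi> s a (Suc k)) f =
      measure_pmf.expectation (state_action_pmf M \<pi> s a k) (next_expectation M \<pi> f)"
    unfolding state_action_pmf.simps
    by (subst pmf_expectation_bind[where A = UNIV])
      (simp_all add: next_expectation_def integral_measure_pmf_real[of UNIV _ "next_expectation M \<pi> f"] mult.commute)
  then show ?case
    by (simp add: Suc.IH funpow_swap1)
qed simp

lemma abs_funpow_next_expectation_le:
  fixes M :: "('s::finite, 'a) mdp"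
  assumes "\<And>x. \<bar>f x\<bar> \<le> c"
  shows "\<bar>(next_expectation M \<pi> ^^ k) f x\<bar> \<le> c"
proof (induction k arbitrary: x)
  case (Suc k)
  then show ?case
    unfolding funpow.simps comp_def next_expectation_def[of M \<pi> _ x]
    by (intro abs_expectation_le_finite)
qed (simp add: assms)

text \<open>On finite spaces the rewards are bounded by some \<open>B\<close>, so the geometric
  series with terms \<open>\<gamma> ^ k * B\<close> dominates everything and expectation and
  infinite sum may be exchanged; each summand then depends only on the marginal at time
  \<open>k\<close>.\<close>

lemma
  fixes M :: "('s::finite, 'a::finite) mdp" and \<pi> :: "'s \<Rightarrow> 'a"
  assumes "is_mdp M"
  defines "T k x \<equiv> mdp_discount M ^ k *
    (next_expectation M \<pi> ^^ k) (\<lambda>x. expected_reward M (fst x) (snd x)) x"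
  shows summable_action_value: "summable (\<lambda>k. T k x)"
    and action_value_eq_suminf: "action_value M \<pi> s a = (\<Sum>k. T k (s, a))"
proof -
  let ?\<gamma> = "mdp_discount M" and ?r = "\<lambda>x. expected_reward M (fst x) (snd x)"
  have \<gamma>: "0 \<le> ?\<gamma>" "?\<gamma> < 1"
    using assms by (auto simp: is_mdp_def)
  define B where "B = (MAX x. \<bar>?r x\<bar>)"
  have B: "\<bar>?r x\<bar> \<le> B" for x
    unfolding B_def by (rule Max_ge) auto
  have geometric: "summable (\<lambda>k. ?\<gamma> ^ k * B)"
    using \<gamma> by (intro summable_mult2 summable_geometric) simp
  show "summable (\<lambda>k. T k x)"
    unfolding T_def using \<gamma> abs_funpow_next_expectation_le[of ?r B, OF B]
    by (intro summable_comparison_test'[OF geometric, of 0])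
      (simp add: abs_mult mult_left_mono)
  interpret prob_space "trajectory M \<pi> s a"
    by (rule prob_space_trajectory)
  have bound: "norm (?\<gamma> ^ k * ?r x) \<le> ?\<gamma> ^ k * B" for k x
    using \<gamma> B[of x] by (simp add: abs_mult mult_left_mono)
  have meas: "(\<lambda>\<omega>. ?\<gamma> ^ k * ?r (\<omega> k)) \<in> borel_measurable (trajectory M \<pi> s a)" for k
    using measurable_compose[OF measurable_trajectory_component, of "\<lambda>x. ?\<gamma> ^ k * ?r x" borel]
    by simp
  have integrable: "integrable (trajectory M \<pi> s a) (\<lambda>\<omega>. ?\<gamma> ^ k * ?r (\<omega> k))" for k
    by (rule integrable_const_bound[OF AE_I2[OF bound] meas])
  have "action_value M \<pi> s a = (\<Sum>k. LINT \<omega>|trajectory M \<pi> s a. ?\<gamma> ^ k * ?r (\<omega> k))"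
    unfolding action_value_def discounted_return_def
  \<comment> \<open>The exchange requires absolute summability pointwise and of the integrated
    norms. The second also follows from the geometric bound because the trajectory law has total
    mass 1.\<close>
  proof (rule integral_suminf[OF integrable])
    show "AE \<omega> in trajectory M \<pi> s a. summable (\<lambda>k. norm (?\<gamma> ^ k * ?r (\<omega> k)))"
      using bound by (intro AE_I2 summable_comparison_test'[OF geometric, of 0])
        (simp only: real_norm_def abs_abs)
    have "norm (LINT \<omega>|trajectory M \<pi> s a. norm (?\<gamma> ^ k * ?r (\<omega> k))) \<le> ?\<gamma> ^ k * B" for k
    proof -
      have "(LINT \<omega>|trajectory M \<pi> s a. norm (?\<gamma> ^ k * ?r (\<omega> k))) \<le>
          (LINT \<omega>|trajectory M \<pi> s a. ?\<gamma> ^ k * B)"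
        using bound by (intro integral_mono integrable_norm integrable) simp_all
      moreover have "0 \<le> (LINT \<omega>|trajectory M \<pi> s a. norm (?\<gamma> ^ k * ?r (\<omega> k)))"
        by (rule Bochner_Integration.integral_nonneg) simp
      ultimately show ?thesis
        by (simp add: prob_space)
    qed
    then show "summable (\<lambda>k. LINT \<omega>|trajectory M \<pi> s a. norm (?\<gamma> ^ k * ?r (\<omega> k)))"
      by (intro summable_comparison_test'[OF geometric, of 0])
  qed
  also have "\<dots> = (\<Sum>k. T k (s, a))"
    by (simp add: T_def integral_trajectory[of _ _ _ _ ?r] expectation_state_action_pmf)
  finally show "action_value M \<pi> s a = (\<Sum>k. T k (s, a))" .
qed

text \<open>Splitting off the term for \<open>k = 0\<close> leaves the immediate reward; the rest is
  the same series started one step later, averaged over the successor state.\<close>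

lemma action_value_Bellman:
  fixes M :: "('s::finite, 'a::finite) mdp"
  assumes "is_mdp M"
  shows "action_value M \<pi> s a = expected_reward M s a + mdp_discount M *
    measure_pmf.expectation (mdp_trans M s a) (\<lambda>s'. action_value M \<pi> s' (\<pi> s'))"
proof -
  let ?\<gamma> = "mdp_discount M" and ?p = "pmf (mdp_trans M s a)"
  define T where "T k x = ?\<gamma> ^ k *
    (next_expectation M \<pi> ^^ k) (\<lambda>x. expected_reward M (fst x) (snd x)) x" for k x
  have summable: "summable (\<lambda>k. T k x)" for x
    unfolding T_def by (rule summable_action_value[OF assms])
  have Q: "action_value M \<pi> s a = (\<Sum>k. T k (s, a))" for s a
    unfolding T_def by (rule action_value_eq_suminf[OF assms])
  \<comment> \<open>The outermost application of \<open>next_expectation\<close> is the first move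
    out of \<open>(s, a)\<close>. Writing it as a finite sum lets it commute with the
    series.\<close>
  have T_Suc: "T (Suc k) (s, a) = ?\<gamma> * (\<Sum>s'\<in>UNIV. ?p s' * T k (s', \<pi> s'))" for k
    by (simp add: T_def next_expectation_def integral_measure_pmf_real[where A = UNIV]
        sum_distrib_left mult_ac)
  have "action_value M \<pi> s a = T 0 (s, a) + (\<Sum>k. T (Suc k) (s, a))"
    unfolding Q using suminf_split_head[OF summable] by simp
  also have "(\<Sum>k. T (Suc k) (s, a)) = ?\<gamma> * (\<Sum>s'\<in>UNIV. ?p s' * (\<Sum>k. T k (s', \<pi> s')))"
    unfolding T_Suc
    by (simp add: suminf_mult suminf_sum summable_sum summable_mult summable)
  finally show ?thesis
    by (simp add: T_def[of 0] Q integral_measure_pmf_real[where A = UNIV] mult.commute)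
qed

section \<open>Comparing tasks and policies by contraction\<close>

text \<open>At a point where \<open>D\<close> attains its maximum \<open>?m\<close>,
  \<open>step\<close> gives \<open>?m \<le> c + \<gamma> * ?m\<close>, which is solved for
  \<open>?m\<close>. Stating \<open>step\<close> for every upper bound \<open>m\<close> keeps the
  maximum out of the applications.\<close>

lemma le_divide_one_minus_discount:
  fixes D :: "'i \<Rightarrow> real"
  assumes \<gamma>: "0 \<le> \<gamma>" "\<gamma> < 1" and X: "finite X"
    and step: "\<And>x m. x \<in> X \<Longrightarrow> (\<And>y. y \<in> X \<Longrightarrow> D y \<le> m) \<Longrightarrow> D x \<le> c + \<gamma> * m"
    and x: "x \<in> X"
  shows "D x \<le> c / (1 - \<gamma>)"
proof -
  let ?m = "Max (D ` X)"
  have le: "D y \<le> ?m" if "y \<in> X" for y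
    using that X by simp
  have "?m \<in> D ` X"
    using X x by (intro Max_in) auto
  then have "?m \<le> c + \<gamma> * ?m"
    using step[OF _ le] by auto
  then have "?m \<le> c / (1 - \<gamma>)"
    using \<gamma> by (simp add: pos_le_divide_eq algebra_simps)
  then show ?thesis
    using le[OF x] by simp
qed

text \<open>With shared dynamics and policy, subtracting the two Bellman equations gives the reward
  gap plus the discounted average of the same difference. The one-sided hypothesis lets the tasks be
  swapped later.\<close>

lemma action_value_diff_le:
  fixes M N :: "('s::finite, 'a::finite) mdp"
  assumes "is_mdp M" "is_mdp N"
    and trans: "mdp_trans N = mdp_trans M" and discount: "mdp_discount N = mdp_discount M"
    and \<delta>: "\<And>s a. expected_reward M s a - expected_reward N s a \<le> \<delta>"
  shows "action_value M \<pi> s a - action_value N \<pi> s a \<le> \<delta> / (1 - mdp_discount M)"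
proof -
  define D where "D x = action_value M \<pi> (fst x) (snd x) - action_value N \<pi> (fst x) (snd x)" for x
  have \<gamma>: "0 \<le> mdp_discount M" "mdp_discount M < 1"
    using assms by (auto simp: is_mdp_def)
  have "D (s, a) \<le> \<delta> / (1 - mdp_discount M)"
  proof (rule le_divide_one_minus_discount[OF \<gamma>, where D = D and X = UNIV])
    fix x m assume m: "\<And>y. y \<in> UNIV \<Longrightarrow> D y \<le> m"
    have "D x = expected_reward M (fst x) (snd x) - expected_reward N (fst x) (snd x) +
        mdp_discount M * measure_pmf.expectation (mdp_trans M (fst x) (snd x)) (\<lambda>s'. D (s', \<pi> s'))"
      unfolding D_def
      by (subst action_value_Bellman[OF assms(1)], subst action_value_Bellman[OF assms(2)])
        (simp add: trans discount integrable_measure_pmf_finite algebra_simps)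
    also have "\<dots> \<le> \<delta> + mdp_discount M * m"
      using m \<gamma> by (intro add_mono \<delta> mult_left_mono expectation_le_const_finite) auto
    finally show "D x \<le> \<delta> + mdp_discount M * m" .
  qed auto
  then show ?thesis
    by (simp add: D_def)
qed

text \<open>Optimality speaks of state values, where the policy also picks the first action. With
  \<open>a\<close> fixed first, the Bellman equation defers the comparison to the successor state,
  where it applies.\<close>

lemma optimal_policy_action_value_le:
  fixes M :: "('s::finite, 'a::finite) mdp"
  assumes M: "is_mdp M" and opt: "optimal_policy M \<pi>"
  shows "action_value M \<pi>' s a \<le> action_value M \<pi> s a"
proof -
  have "action_value M \<pi>' s' (\<pi>' s') \<le> action_value M \<pi> s' (\<pi> s')" for s'
    using opt unfolding optimal_policy_def state_value_def action_value_def by blast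
  moreover have "0 \<le> mdp_discount M"
    using M by (simp add: is_mdp_def)
  ultimately show ?thesis
    unfolding action_value_Bellman[OF M, of _ s a]
    by (intro add_left_mono mult_left_mono expectation_mono_finite)
qed

text \<open>Detour through \<open>N\<close>: evaluating \<pi>' in \<open>N\<close> instead of
  \<open>M\<close> costs one \<delta> term, passing from \<pi>' to \<pi> inside \<open>N\<close>
  costs nothing, and returning to \<open>M\<close> costs the second.\<close>

lemma optimal_policy_transfer:
  fixes M N :: "('s::finite, 'a::finite) mdp"
  assumes "is_mdp M" "is_mdp N"
    and trans: "mdp_trans N = mdp_trans M" and discount: "mdp_discount N = mdp_discount M"
    and \<delta>: "\<And>s a. \<bar>expected_reward M s a - expected_reward N s a\<bar> \<le> \<delta>"
    and opt: "optimal_policy N \<pi>"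
  shows "action_value M \<pi>' s a - action_value M \<pi> s a \<le> 2 * \<delta> / (1 - mdp_discount M)"
proof -
  have \<delta>': "expected_reward M s a - expected_reward N s a \<le> \<delta>"
    "expected_reward N s a - expected_reward M s a \<le> \<delta>" for s a
    using \<delta>[of s a] by linarith+
  have "action_value M \<pi>' s a - action_value N \<pi>' s a \<le> \<delta> / (1 - mdp_discount M)"
    by (rule action_value_diff_le[OF assms(1,2) trans discount \<delta>'(1)])
  moreover have "action_value N \<pi> s a - action_value M \<pi> s a \<le> \<delta> / (1 - mdp_discount M)"
    using action_value_diff_le[OF assms(2,1) trans[symmetric] discount[symmetric] \<delta>'(2)]
    by (simp add: discount)
  moreover have "action_value N \<pi>' s a \<le> action_value N \<pi> s a"
    by (rule optimal_policy_action_value_le[OF assms(2) opt])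
  moreover have "2 * \<delta> / (1 - mdp_discount M) =
      \<delta> / (1 - mdp_discount M) + \<delta> / (1 - mdp_discount M)"
    by simp
  ultimately show ?thesis
    by linarith
qed

lemma generalized_policy_improvement:
  fixes M :: "('s::finite, 'a::finite) mdp"
  assumes M: "is_mdp M" and J: "finite J" and j: "j \<in> J"
    and approx: "\<And>j s a. j \<in> J \<Longrightarrow> \<bar>action_value M (\<mu> j) s a - Q j s a\<bar> \<le> \<epsilon>"
    and greedy: "\<And>s. is_arg_max (\<lambda>a. MAX j\<in>J. Q j s a) (\<lambda>_. True) (\<pi> s)"
  shows "action_value M (\<mu> j) s a - action_value M \<pi> s a \<le> 2 * \<epsilon> / (1 - mdp_discount M)"
proof -
  define D where "D = (\<lambda>(j, s, a). action_value M (\<mu> j) s a - action_value M \<pi> s a)"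
  have \<gamma>: "0 \<le> mdp_discount M" "mdp_discount M < 1"
    using M by (auto simp: is_mdp_def)
  have \<epsilon>: "0 \<le> \<epsilon>"
    using approx[OF j, of s a] by linarith
  have "D (j, s, a) \<le> 2 * \<epsilon> / (1 - mdp_discount M)"
  proof (rule le_divide_one_minus_discount[OF \<gamma>, where D = D and X = "J \<times> UNIV"])
    fix x m assume x: "x \<in> J \<times> (UNIV :: ('s \<times> 'a) set)" and m: "\<And>y. y \<in> J \<times> UNIV \<Longrightarrow> D y \<le> m"
    obtain i t b where x_eq: "x = (i, t, b)" and i: "i \<in> J"
      using x by (cases x) auto
    \<comment> \<open>Let \<open>l\<close> attain the maximum at the greedy action. Passing from
      \<mu> \<open>i\<close> to \<mu> \<open>l\<close> there loses at most \<epsilon> for each of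
      the two approximations, and the remaining gap is a value of \<open>D\<close> at index
      \<open>l\<close>, so at most \<open>m\<close>.\<close>
    have next_le: "action_value M (\<mu> i) s' (\<mu> i s') - action_value M \<pi> s' (\<pi> s') \<le> m + 2 * \<epsilon>" for s'
    proof -
      have "(MAX j\<in>J. Q j s' (\<pi> s')) \<in> (\<lambda>j. Q j s' (\<pi> s')) ` J"
        using J j by (intro Max_in) auto
      then obtain l where l: "l \<in> J" "(MAX j\<in>J. Q j s' (\<pi> s')) = Q l s' (\<pi> s')"
        by auto
      have "Q i s' (\<mu> i s') \<le> (MAX j\<in>J. Q j s' (\<mu> i s'))"
        using J i by simp
      also have "\<dots> \<le> Q l s' (\<pi> s')"
        using greedy[of s'] l(2) by (force simp: is_arg_max_def not_less)
      finally show ?thesis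
        using approx[OF i, of s' "\<mu> i s'"] approx[OF l(1), of s' "\<pi> s'"] m[of "(l, s', \<pi> s')"] l(1)
        by (simp add: D_def)
    qed
    have "D x = mdp_discount M * measure_pmf.expectation (mdp_trans M t b)
        (\<lambda>s'. action_value M (\<mu> i) s' (\<mu> i s') - action_value M \<pi> s' (\<pi> s'))"
      unfolding D_def x_eq prod.case action_value_Bellman[OF M, of _ t b]
      by (simp add: integrable_measure_pmf_finite algebra_simps)
    also have "\<dots> \<le> mdp_discount M * (m + 2 * \<epsilon>)"
      using \<gamma> next_le by (intro mult_left_mono expectation_le_const_finite) auto
    \<comment> \<open>The discount on the error term is dropped, which is sound because \<epsilon>
      is nonnegative as a bound on an absolute value.\<close>
    also have "\<dots> \<le> 2 * \<epsilon> + mdp_discount M * m"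
      using \<gamma> \<epsilon> mult_left_le_one_le[of "2 * \<epsilon>" "mdp_discount M"] by (simp add: distrib_left)
    finally show "D x \<le> 2 * \<epsilon> + mdp_discount M * m" .
  qed (use J j in auto)
  then show ?thesis
    by (simp add: D_def)
qed

section \<open>Linear rewards and the final bound\<close>

lemma expected_reward_eq_inner:
  fixes M :: "('s::finite, 'a) mdp"
  assumes "has_weights \<phi> M w"
  shows "expected_reward M s a = expected_feature (mdp_trans M) \<phi> s a \<bullet> w"
proof -
  have "transition_reward M s a = (\<lambda>s'. \<phi> s a s' \<bullet> w)"
    using assms by (auto simp: has_weights_def)
  then show ?thesis
    by (simp add: expected_reward_def expected_feature_def integrable_measure_pmf_finite)
qed

theorem theorem2:
  fixes p :: "'s::finite \<Rightarrow> 'a::finite \<Rightarrow> 's pmf"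
    and \<gamma> \<epsilon> :: real
    and \<phi> :: "'s \<Rightarrow> 'a \<Rightarrow> 's \<Rightarrow> 'v::euclidean_space"
    and n :: nat
    and M :: "nat \<Rightarrow> ('s, 'a) mdp" and w :: "nat \<Rightarrow> 'v"
    and Mi :: "('s, 'a) mdp" and wi :: 'v
    and \<pi>opt :: "nat \<Rightarrow> 's \<Rightarrow> 'a" and \<pi>i \<pi> :: "'s \<Rightarrow> 'a"
    and Qt :: "nat \<Rightarrow> 's \<Rightarrow> 'a \<Rightarrow> real"
  assumes "0 \<le> \<gamma>" and "\<gamma> < 1" and "1 \<le> n"
    and "\<And>j. j \<in> {1..n} \<Longrightarrow> M j \<in> mdp_family \<phi> p \<gamma>"
    and "\<And>j. j \<in> {1..n} \<Longrightarrow> has_weights \<phi> (M j) (w j)"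
    and "Mi \<in> mdp_family \<phi> p \<gamma>"
    and "has_weights \<phi> Mi wi"
    and "\<And>j. j \<in> {1..n} \<Longrightarrow> optimal_policy (M j) (\<pi>opt j)"
    and "optimal_policy Mi \<pi>i"
    and "\<And>j s a. j \<in> {1..n} \<Longrightarrow> \<bar>action_value Mi (\<pi>opt j) s a - Qt j s a\<bar> \<le> \<epsilon>"
    and "\<And>s. is_arg_max (\<lambda>a. MAX j\<in>{1..n}. Qt j s a) (\<lambda>a. True) (\<pi> s)"
  shows "action_value Mi \<pi>i s a - action_value Mi \<pi> s a
    \<le> 2 / (1 - \<gamma>) *
      ((MAX (s, a)\<in>UNIV. norm (expected_feature p \<phi> s a)) * (MIN j\<in>{1..n}. norm (wi - w j)) + \<epsilon>)"
proof -
  let ?\<Phi> = "MAX (s, a)\<in>UNIV. norm (expected_feature p \<phi> s a)"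
  have Mi: "is_mdp Mi" "mdp_trans Mi = p" "mdp_discount Mi = \<gamma>"
    using assms(6) by (auto simp: mdp_family_def)
  \<comment> \<open>Choose the source task \<open>j\<close> with weights nearest to
    \<open>wi\<close>; the index set is nonempty as \<open>1 \<le> n\<close>.\<close>
  have "(MIN j\<in>{1..n}. norm (wi - w j)) \<in> (\<lambda>j. norm (wi - w j)) ` {1..n}"
    using assms(3) by (intro Min_in) auto
  then obtain j where j: "j \<in> {1..n}"
    and min: "(MIN j\<in>{1..n}. norm (wi - w j)) = norm (wi - w j)"
    by auto
  have Mj: "is_mdp (M j)" "mdp_trans (M j) = p" "mdp_discount (M j) = \<gamma>"
    using assms(4)[OF j] by (auto simp: mdp_family_def)
  \<comment> \<open>By linearity the reward gap is an inner product with \<open>wi - w j\<close>, so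
    Cauchy-Schwarz provides the \<delta> for the transfer bound.\<close>
  have \<delta>: "\<bar>expected_reward Mi s a - expected_reward (M j) s a\<bar> \<le> ?\<Phi> * norm (wi - w j)" for s a
  proof -
    have "expected_reward Mi s a - expected_reward (M j) s a = expected_feature p \<phi> s a \<bullet> (wi - w j)"
      by (simp add: expected_reward_eq_inner[OF assms(7)] expected_reward_eq_inner[OF assms(5)[OF j]]
          Mi Mj inner_diff_right)
    also have "\<bar>\<dots>\<bar> \<le> norm (expected_feature p \<phi> s a) * norm (wi - w j)"
      by (rule Cauchy_Schwarz_ineq2)
    also have "norm (expected_feature p \<phi> s a) \<le> ?\<Phi>"
      by (rule Max_ge) (auto intro!: image_eqI[of _ _ "(s, a)"])
    finally show ?thesis
      by (simp add: mult_right_mono)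
  qed
  \<comment> \<open>The policy \<open>\<pi>opt j\<close>, run in \<open>Mi\<close>, is the
    intermediate point: transfer bounds the gap above it, policy improvement the gap below.\<close>
  have "action_value Mi \<pi>i s a - action_value Mi (\<pi>opt j) s a \<le> 2 * (?\<Phi> * norm (wi - w j)) / (1 - \<gamma>)"
    using optimal_policy_transfer[OF Mi(1) Mj(1) _ _ \<delta> assms(8)[OF j]] by (simp add: Mi Mj)
  moreover have "action_value Mi (\<pi>opt j) s a - action_value Mi \<pi> s a \<le> 2 * \<epsilon> / (1 - \<gamma>)"
    using generalized_policy_improvement[where M = Mi and \<mu> = \<pi>opt and Q = Qt and \<pi> = \<pi>,
        OF Mi(1) _ j assms(10) assms(11)] by (simp add: Mi)
  ultimately show ?thesis
    unfolding min by (simp add: distrib_left add_divide_distrib)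
qed

end
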